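(* Let $(Z,\preceq)$ be a preordered set, let $\Psi$ be a non-empty family of functions $\psi\colon Z\to\mathbb{R}\cup\{\pm\infty\}$ which are monotone with respect to $\preceq$, and let $X$ be a non-empty set. Let $\varepsilon>0$ and let $f\colon X\to\mathcal{P}(Z,\Psi)$ be a function. Then there is an $(\varepsilon,\Psi)$-solution of the problem: minimize $f(x)$ over $x\in X$.
   Context: A function $\psi\colon Z\to\mathbb{R}\cup\{\pm\infty\}$ is monotone if $z_1\preceq z_2$ implies $\psi(z_1)\le\psi(z_2)$. For $D\subseteq Z$, $\psi^\triangle(D)=\inf_{z\in D}\psi(z)$ (with $\inf_{z\in\emptyset}\psi(z)=+\infty$) and $\operatorname{cl}_\Psi D=\bigcap_{\psi\in\Psi}\{z\in Z\mid \psi^\triangle(D)\le\psi(z)\}$; $\mathcal{P}(Z,\Psi)=\{D\subseteq Z\mid D=\operatorname{cl}_\Psi D\}$, ordered by $\supseteq$, is a complete lattice in which $\inf\mathcal{A}=\operatorname{cl}_\Psi\bigcup_{A\in\mathcal{A}}A$. For $M\subseteq X$, $\inf f[M]=\operatorname{cl}_\Psi\bigcup_{x\in M}f(x)$. For $\varepsilon\ge 0$ and $\psi\in\Psi$ put $b_\varepsilon(\psi)=\psi^\triangle(\inf f[X])+\varepsilon$ if $\psi^\triangle(\inf f[X])\ne-\infty$ and $b_\varepsilon(\psi)=-\frac1\varepsilon$ if $\psi^\triangle(\inf f[X])=-\infty$, with the conventions $-\frac10=-\infty$ and $+\infty+\varepsilon=+\infty$. A non-empty set $M\subseteq X$ is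 an $(\varepsilon,\Psi)$-infimizer of $f$ if $\psi^\triangle(\inf f[M])\le b_\varepsilon(\psi)$ for all $\psi\in\Psi$. An element $x\in X$ is an $(\varepsilon,\Psi)$-minimizer of $f$ if there exists $\psi\in\Psi$ with $\psi^\triangle(f(x))\le b_\varepsilon(\psi)$. A non-empty set $M\subseteq X$ is an $(\varepsilon,\Psi)$-solution of the problem if it is an $(\varepsilon,\Psi)$-infimizer of $f$ and each element of $M$ is an $(\varepsilon,\Psi)$-minimizer of $f$. *)

theory Defs
  imports "HOL-Library.Extended_Real" "HOL-Library.FuncSet"
begin

text \<open>
  The preordered set is a carrier \<open>Z\<close> with a relation satisfying \<open>preorder_on Z R\<close>; it may be
  empty. A member of \<open>\<Psi>\<close> is a function on the whole type, but only its values on \<open>Z\<close> matter,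
  since all sets it is evaluated on are subsets of \<open>Z\<close>.
\<close>

definition monotone_family :: "'z set \<Rightarrow> 'z rel \<Rightarrow> ('z \<Rightarrow> ereal) set \<Rightarrow> bool" where
  "monotone_family Z R \<Psi> \<longleftrightarrow> (\<forall>\<psi>\<in>\<Psi>. monotone_on Z (\<lambda>z\<^sub>1 z\<^sub>2. (z\<^sub>1, z\<^sub>2) \<in> R) (\<le>) \<psi>)"

text \<open>\<open>\<psi>\<^sup>\<triangle>(D)\<close>; the infimum over the empty set is \<open>top = \<infinity>\<close> in \<^typ>\<open>ereal\<close>.\<close>

definition inf_ext :: "('z \<Rightarrow> ereal) \<Rightarrow> 'z set \<Rightarrow> ereal" where
  "inf_ext \<psi> D = (INF z\<in>D. \<psi> z)"

definition cl :: "'z set \<Rightarrow> ('z \<Rightarrow> ereal) set \<Rightarrow> 'z set \<Rightarrow> 'z set" where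
  "cl Z \<Psi> D = (\<Inter>\<psi>\<in>\<Psi>. {z \<in> Z. inf_ext \<psi> D \<le> \<psi> z})"

definition closed_sets :: "'z set \<Rightarrow> ('z \<Rightarrow> ereal) set \<Rightarrow> 'z set set" where
  "closed_sets Z \<Psi> = {D. D \<subseteq> Z \<and> D = cl Z \<Psi> D}"

definition inf_lattice :: "'z set \<Rightarrow> ('z \<Rightarrow> ereal) set \<Rightarrow> 'z set set \<Rightarrow> 'z set" where
  "inf_lattice Z \<Psi> \<A> = cl Z \<Psi> (\<Union>\<A>)"

text \<open>For a non-empty family, \<^const>\<open>inf_lattice\<close> is the infimum with respect to \<open>\<supseteq>\<close>.\<close>

lemma inf_lattice_greatest_lower_bound:
  assumes "\<Psi> \<noteq> {}" "\<A> \<subseteq> closed_sets Z \<Psi>"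
  shows "inf_lattice Z \<Psi> \<A> \<in> closed_sets Z \<Psi>"
    and "\<And>A. A \<in> \<A> \<Longrightarrow> inf_lattice Z \<Psi> \<A> \<supseteq> A"
    and "\<And>B. B \<in> closed_sets Z \<Psi> \<Longrightarrow> (\<And>A. A \<in> \<A> \<Longrightarrow> B \<supseteq> A) \<Longrightarrow> B \<supseteq> inf_lattice Z \<Psi> \<A>"
proof -
  have ext: "D \<subseteq> cl Z \<Psi> D" if "D \<subseteq> Z" for D
    using that by (auto simp: cl_def inf_ext_def intro: INF_lower)
  have mono: "cl Z \<Psi> D \<subseteq> cl Z \<Psi> E" if "D \<subseteq> E" for D E
  proof -
    have "inf_ext \<psi> E \<le> inf_ext \<psi> D" for \<psi>
      unfolding inf_ext_def using that by (rule INF_superset_mono) simp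
    then show ?thesis by (auto simp: cl_def intro: order_trans)
  qed
  have sub: "cl Z \<Psi> D \<subseteq> Z" for D
    using assms(1) by (auto simp: cl_def)
  have "inf_ext \<psi> D \<le> inf_ext \<psi> (cl Z \<Psi> D)" if "\<psi> \<in> \<Psi>" for \<psi> D
    unfolding inf_ext_def[of \<psi> "cl Z \<Psi> D"]
    by (rule INF_greatest) (use that in \<open>auto simp: cl_def\<close>)
  then have idem: "cl Z \<Psi> (cl Z \<Psi> D) \<subseteq> cl Z \<Psi> D" for D
    by (subst (1 3) cl_def) (auto intro: order_trans)
  have union: "\<Union>\<A> \<subseteq> Z"
    using assms(2) by (auto simp: closed_sets_def)
  show "inf_lattice Z \<Psi> \<A> \<in> closed_sets Z \<Psi>"
    unfolding closed_sets_def inf_lattice_def using sub idem ext[OF sub] by blast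
  show "inf_lattice Z \<Psi> \<A> \<supseteq> A" if "A \<in> \<A>" for A
    unfolding inf_lattice_def using ext[OF union] that by blast
  show "B \<supseteq> inf_lattice Z \<Psi> \<A>"
    if "B \<in> closed_sets Z \<Psi>" "\<And>A. A \<in> \<A> \<Longrightarrow> B \<supseteq> A" for B
    unfolding inf_lattice_def using that mono[of "\<Union>\<A>" B] by (auto simp: closed_sets_def)
qed

definition bound ::
  "'z set \<Rightarrow> ('z \<Rightarrow> ereal) set \<Rightarrow> 'x set \<Rightarrow> ('x \<Rightarrow> 'z set) \<Rightarrow> real \<Rightarrow> ('z \<Rightarrow> ereal) \<Rightarrow> ereal" where
  "bound Z \<Psi> X f \<epsilon> \<psi> =
     (if inf_ext \<psi> (inf_lattice Z \<Psi> (f ` X)) \<noteq> -\<infinity>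
      then inf_ext \<psi> (inf_lattice Z \<Psi> (f ` X)) + ereal \<epsilon>
      else if \<epsilon> = 0 then -\<infinity> else ereal (- 1 / \<epsilon>))"

definition infimizer ::
  "'z set \<Rightarrow> ('z \<Rightarrow> ereal) set \<Rightarrow> 'x set \<Rightarrow> ('x \<Rightarrow> 'z set) \<Rightarrow> real \<Rightarrow> 'x set \<Rightarrow> bool" where
  "infimizer Z \<Psi> X f \<epsilon> M \<longleftrightarrow> M \<noteq> {} \<and> M \<subseteq> X \<and>
     (\<forall>\<psi>\<in>\<Psi>. inf_ext \<psi> (inf_lattice Z \<Psi> (f ` M)) \<le> bound Z \<Psi> X f \<epsilon> \<psi>)"

definition minimizer ::
  "'z set \<Rightarrow> ('z \<Rightarrow> ereal) set \<Rightarrow> 'x set \<Rightarrow> ('x \<Rightarrow> 'z set) \<Rightarrow> real \<Rightarrow> 'x \<Rightarrow> bool" where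
  "minimizer Z \<Psi> X f \<epsilon> x \<longleftrightarrow> x \<in> X \<and> (\<exists>\<psi>\<in>\<Psi>. inf_ext \<psi> (f x) \<le> bound Z \<Psi> X f \<epsilon> \<psi>)"

definition solution ::
  "'z set \<Rightarrow> ('z \<Rightarrow> ereal) set \<Rightarrow> 'x set \<Rightarrow> ('x \<Rightarrow> 'z set) \<Rightarrow> real \<Rightarrow> 'x set \<Rightarrow> bool" where
  "solution Z \<Psi> X f \<epsilon> M \<longleftrightarrow> M \<noteq> {} \<and> M \<subseteq> X \<and>
     infimizer Z \<Psi> X f \<epsilon> M \<and> (\<forall>x\<in>M. minimizer Z \<Psi> X f \<epsilon> x)"

end

theory Submission
  imports Defs
begin

text \<open>
  The set of all \<open>(\<epsilon>, \<Psi>)\<close>-minimizers is a solution. Passing to the closure \<^const>\<open>cl\<close> does not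
  change the infimum of any \<open>\<psi> \<in> \<Psi>\<close>, so the value of \<open>\<psi>\<close> at the lattice infimum of \<open>f\<close> is the
  ordinary infimum in the extended reals of the numbers \<open>\<psi>\<^sup>\<triangle>(f(x))\<close> (\<open>inf_ext_inf_lattice\<close>). Since
  \<open>\<epsilon> > 0\<close>, the bound lies strictly above this infimum unless it is \<open>+\<infinity>\<close>, where the
  bound holds at every point; hence every single \<open>\<psi>\<close> has a point of \<open>X\<close> below the bound
  (\<open>exists_point_below_bound\<close>). Such a point is a minimizer with witness \<open>\<psi>\<close>, so the set of all
  minimizers contains one for each \<open>\<psi>\<close>. It is therefore non-empty, and because enlarging a set
  only lowers infima, it satisfies all the inequalities of an infimizer simultaneously.
\<close>

lemma inf_ext_cl:
  assumes "\<psi> \<in> \<Psi>" "D \<subseteq> Z"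
  shows "inf_ext \<psi> (cl Z \<Psi> D) = inf_ext \<psi> D"
proof (rule antisym)
  have "D \<subseteq> cl Z \<Psi> D"
    using assms(2) by (auto simp: cl_def inf_ext_def intro: INF_lower)
  then show "inf_ext \<psi> (cl Z \<Psi> D) \<le> inf_ext \<psi> D"
    unfolding inf_ext_def by (rule INF_superset_mono) simp
  show "inf_ext \<psi> D \<le> inf_ext \<psi> (cl Z \<Psi> D)"
    unfolding inf_ext_def[of \<psi> "cl Z \<Psi> D"]
    by (rule INF_greatest) (use assms(1) in \<open>auto simp: cl_def\<close>)
qed

lemma inf_ext_inf_lattice:
  assumes "\<psi> \<in> \<Psi>" "\<And>x. x \<in> M \<Longrightarrow> f x \<subseteq> Z"
  shows "inf_ext \<psi> (inf_lattice Z \<Psi> (f ` M)) = (INF x\<in>M. inf_ext \<psi> (f x))"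
proof -
  have "\<Union>(f ` M) \<subseteq> Z"
    using assms(2) by blast
  then have "inf_ext \<psi> (inf_lattice Z \<Psi> (f ` M)) = inf_ext \<psi> (\<Union>(f ` M))"
    unfolding inf_lattice_def by (rule inf_ext_cl[OF assms(1)])
  also have "\<dots> = (INF x\<in>M. inf_ext \<psi> (f x))"
    unfolding inf_ext_def
    by (intro antisym INF_greatest) (auto intro: INF_lower INF_lower2)
  finally show ?thesis .
qed

text \<open>
  Were all values above the bound, their infimum would be at least the bound; this is impossible
  when adding \<open>\<epsilon>\<close> to a finite infimum, or replacing \<open>-\<infinity>\<close> by \<open>- 1 / \<epsilon>\<close>, strictly increases it.
\<close>

lemma exists_point_below_bound:
  assumes "\<psi> \<in> \<Psi>" "X \<noteq> {}" "\<epsilon> > 0" "\<And>x. x \<in> X \<Longrightarrow> f x \<subseteq> Z"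
  shows "\<exists>x\<in>X. inf_ext \<psi> (f x) \<le> bound Z \<Psi> X f \<epsilon> \<psi>"
proof -
  define v where "v = inf_ext \<psi> (inf_lattice Z \<Psi> (f ` X))"
  have bound: "bound Z \<Psi> X f \<epsilon> \<psi> = (if v \<noteq> -\<infinity> then v + ereal \<epsilon> else ereal (- 1 / \<epsilon>))"
    using assms(3) by (simp add: bound_def v_def)
  show ?thesis
  proof (cases "v = \<infinity>")
    case True
    then show ?thesis
      using assms(2) by (auto simp: bound)
  next
    case False
    then have "v < bound Z \<Psi> X f \<epsilon> \<psi>"
      using assms(3) by (cases v) (auto simp: bound)
    moreover have "v = (INF x\<in>X. inf_ext \<psi> (f x))"
      unfolding v_def by (rule inf_ext_inf_lattice[OF assms(1,4)])
    ultimately show ?thesis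
      by (auto simp: INF_less_iff intro: less_imp_le)
  qed
qed

theorem proposition3p9:
  fixes Z :: "'z set" and R :: "'z rel" and \<Psi> :: "('z \<Rightarrow> ereal) set"
    and X :: "'x set" and f :: "'x \<Rightarrow> 'z set" and \<epsilon> :: real
  assumes "preorder_on Z R"
    and "\<Psi> \<noteq> {}"
    and "monotone_family Z R \<Psi>"
    and "X \<noteq> {}"
    and "\<epsilon> > 0"
    and "f \<in> X \<rightarrow> closed_sets Z \<Psi>"
  shows "\<exists>M. solution Z \<Psi> X f \<epsilon> M"
proof -
  define M where "M = {x. minimizer Z \<Psi> X f \<epsilon> x}"
  have f_sub: "f x \<subseteq> Z" if "x \<in> X" for x
    using assms(6) that by (auto simp: closed_sets_def)
  have M_sub: "M \<subseteq> X"
    by (auto simp: M_def minimizer_def)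
  have point: "\<exists>x\<in>M. inf_ext \<psi> (f x) \<le> bound Z \<Psi> X f \<epsilon> \<psi>" if psi: "\<psi> \<in> \<Psi>" for \<psi>
  proof -
    obtain x where "x \<in> X" "inf_ext \<psi> (f x) \<le> bound Z \<Psi> X f \<epsilon> \<psi>"
      using exists_point_below_bound[where f = f, OF psi assms(4,5) f_sub] by blast
    then show ?thesis
      using psi by (auto simp: M_def minimizer_def)
  qed
  have M_ne: "M \<noteq> {}"
    using point assms(2) by blast
  have "inf_ext \<psi> (inf_lattice Z \<Psi> (f ` M)) \<le> bound Z \<Psi> X f \<epsilon> \<psi>" if "\<psi> \<in> \<Psi>" for \<psi>
  proof -
    have "inf_ext \<psi> (inf_lattice Z \<Psi> (f ` M)) = (INF x\<in>M. inf_ext \<psi> (f x))"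
      using that M_sub f_sub by (intro inf_ext_inf_lattice) auto
    then show ?thesis
      using point[OF that] by (auto intro: INF_lower2)
  qed
  then have "solution Z \<Psi> X f \<epsilon> M"
    using M_sub M_ne by (auto simp: solution_def infimizer_def M_def)
  then show ?thesis ..
qed

end
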